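(* Let $k\ge 1$ and $r>k$ be integers. (i) (Dimension $1+1$.) Let $S=[x_-,x_+]\times[y_-,y_+]$ be a cell, and let $\widetilde{\mathcal X}_k(S)=\mathcal X_k(S)+\operatorname{span}\{\psi\}$ be an augmented space for the bilinear form $\mathcal L$ of the DG scheme for $\partial_x(\alpha u)+\partial_y(\beta u)+\gamma u=f$, where $\psi\in\mathcal X_r(S)\setminus\mathcal X_k(S)$ (see context). Let $u\in\widetilde{\mathcal X}_k(S)$ be a solution of the local DG scheme $$\mathcal L(u,v)=\mathcal R(v)\qquad\text{for all } v\in\widetilde{\mathcal X}_k(S).$$ If the source term satisfies $f\ge 0$ on $S$ and the inflow data on $S$ (coming from the upstream cells or from the inflow boundary conditions) are non-negative, then the cell average of $u$ is non-negative: $$\overline u_S=\frac1{|S|}\int_S u\,dx\,dy\ \ge 0 .$$ (ii) (Dimension $1+2$.) The analogous statement holds for a cell $S=[x_-,x_+]\times[y_-,y_+]\times[t_-,t_+]$ and the space-time DG scheme for $\partial_t u+\alpha\,\partial_x u+\beta\,\partial_y u+\gamma u=f$: if $\widetilde{\mathcal X}_k(S)=\mathcal X_k(S)+\operatorname{span}\{\psi\}$, with $\psi\in\mathcal X_r(S)\setminus\mathcal X_k(S)$, is an augmented space for the corresponding bilinear form $\mathcal L$, if $u\in\widetilde{\mathcal X}_k(S)$ satisfies $\mathcal L(u,v)=\mathcal R(v)$ for all $v\in\widetilde{\mathcal X}_k(S)$, and if $f\ge0$ on $S$ and the inflow data on $S$ are non-negative, then $$\overline u_S=\frac1{|S|}\int_S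 u\,dx\,dy\,dt\ \ge 0 .$$
   Context: **Coefficients.** In dimension $1+1$, $\alpha,\beta>0$ and $\gamma\ge0$ are constants or, more generally, continuous functions on $S$ with these signs. In dimension $1+2$, $\alpha,\beta>0$ and $\gamma\ge 0$ are constants. The source $f$ and the inflow data below are given real-valued integrable functions. **Polynomial spaces.** $\mathcal X_k(S)$ denotes the restriction to $S$ of one of the following standard polynomial spaces in the coordinate variables: $\mathcal P_k$ (total degree at most $k$), $\mathcal Q_k$ (degree at most $k$ in each variable), or the serendipity space $\mathcal S_k$ (the span of all monomials whose total degree, ignoring the variables that enter linearly, is at most $k$). $\mathcal X_r(S)$ is the space of the same family with $r$ in place of $k$. **Local DG scheme in dimension $1+1$.** On $S=[x_-,x_+]\times[y_-,y_+]$ let $g_1(y)$, $y\in[y_-,y_+]$, and $g_2(x)$, $x\in[x_-,x_+]$, be the inflow data on the edges $x=x_-$ and $y=y_-$ respectively. These are the traces on those edges of the numerical solution in the adjacent upstream cell, or the prescribed inflow boundary values if the edge lies on the inflow boundary of the domain. For polynomials $u,v$ on $S$, $$\mathcal L(u,v)=-\int_S u\,(\alpha v_x+\beta v_y)\,dx\,dy+\int_{y_-}^{y_+}(\alpha u v)(x_+,y)\,dy+\int_{x_-}^{x_+}(\beta u v)(x,y_+)\,dx+\int_S\gamma uv\,dx\,dy,$$ $$\mathcal R(v)=\int_S f v\,dx\,dy+\int_{y_-}^{y_+}\alpha(x_-,y)\, g_1(y)\,v(x_-,y)\,dy+\int_{x_-}^{x_+}\beta(x,y_-)\, g_2(x)\,v(x,y_-)\,dx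 .$$ **Local DG scheme in dimension $1+2$.** On $S=[x_-,x_+]\times[y_-,y_+]\times[t_-,t_+]$ let $g_1(y,t)$, $g_2(x,t)$, $g_3(x,y)$ be the inflow data on the faces $x=x_-$, $y=y_-$, $t=t_-$ respectively (traces from the upstream cells, or prescribed inflow boundary/initial values). For polynomials $u,v$ on $S$, $$\mathcal L(u,v)=-\int_S u\,(\alpha v_x+\beta v_y+v_t-\gamma v)\,dx\,dy\,dt+\alpha\int_{t_-}^{t_+}\!\!\int_{y_-}^{y_+}(uv)(x_+,y,t)\,dy\,dt+\beta\int_{t_-}^{t_+}\!\!\int_{x_-}^{x_+}(uv)(x,y_+,t)\,dx\,dt+\int_{y_-}^{y_+}\!\!\int_{x_-}^{x_+}(uv)(x,y,t_+)\,dx\,dy,$$ $$\mathcal R(v)=\int_S fv\,dx\,dy\,dt+\alpha\int_{t_-}^{t_+}\!\!\int_{y_-}^{y_+}g_1(y,t)\,v(x_-,y,t)\,dy\,dt+\beta\int_{t_-}^{t_+}\!\!\int_{x_-}^{x_+}g_2(x,t)\,v(x,y_-,t)\,dx\,dt+\int_{y_-}^{y_+}\!\!\int_{x_-}^{x_+}g_3(x,y)\,v(x,y,t_-)\,dx\,dy .$$ **Augmented space.** For $\psi\in\mathcal X_r(S)\setminus\mathcal X_k(S)$, the space $\widetilde{\mathcal X}_k(S)=\mathcal X_k(S)+\operatorname{span}\{\psi\}$ is called an augmented space (for $\mathcal L$) if $\psi$ is feasible in the following sense: there exists $\widetilde v\in\widetilde{\mathcal X}_k(S)$ such that $\widetilde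 v\ge0$ on $S$ and $$\mathcal L(\widetilde u,\widetilde v)=\int_S\widetilde u\qquad\text{for all }\widetilde u\in\widetilde{\mathcal X}_k(S),$$ where the integral is with respect to Lebesgue measure on $S$. $|S|$ denotes the Lebesgue measure of $S$. *)

theory Defs
  imports "HOL-Analysis.Analysis" "HOL-Library.Function_Algebras"
begin

text \<open>
  Functions into the reals are not an instance of \<^class>\<open>real_vector\<close>, so the library's span is
  obtained by interpreting \<^locale>\<open>vector_space\<close> with pointwise scaling.
\<close>

interpretation fun_space: vector_space "\<lambda>(c::real) (f::'a \<Rightarrow> real) x. c * f x"
  by unfold_locales (auto simp: fun_eq_iff algebra_simps)

datatype poly_family = Total_Degree | Tensor_Product | Serendipity

text \<open>
  The coordinates of a point \<open>x\<close> are \<open>x \<bullet> b\<close> for \<open>b \<in> Basis\<close>; on \<open>real \<times> real\<close> and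
  \<open>real \<times> real \<times> real\<close> these are the components of the tuple.
\<close>

definition monomial_fun :: "('a::euclidean_space \<Rightarrow> nat) \<Rightarrow> 'a \<Rightarrow> real" where
  "monomial_fun e x = (\<Prod>b\<in>Basis. (x \<bullet> b) ^ e b)"

fun exponent_le :: "poly_family \<Rightarrow> nat \<Rightarrow> ('a::euclidean_space \<Rightarrow> nat) \<Rightarrow> bool" where
  "exponent_le Total_Degree k e \<longleftrightarrow> (\<Sum>b\<in>Basis. e b) \<le> k"
| "exponent_le Tensor_Product k e \<longleftrightarrow> (\<forall>b\<in>Basis. e b \<le> k)"
| "exponent_le Serendipity k e \<longleftrightarrow> (\<Sum>b\<in>{b \<in> Basis. e b \<noteq> 1}. e b) \<le> k"

text \<open>
  Elements of the spaces are kept as polynomial functions on the whole Euclidean space. On a cell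
  with non-empty interior this is the same as working with their restrictions, by
  \<open>poly_space_eqI\<close> below, and partial derivatives make sense up to the boundary of the cell.
\<close>

definition poly_space :: "poly_family \<Rightarrow> nat \<Rightarrow> ('a::euclidean_space \<Rightarrow> real) set" where
  "poly_space X k = fun_space.span {monomial_fun e |e. exponent_le X k e}"

lemma poly_space_real_polynomial_function:
  assumes "p \<in> poly_space X k"
  shows "real_polynomial_function p"
  using assms unfolding poly_space_def
proof (induction rule: fun_space.span_induct_alt)
  case base
  have "real_polynomial_function (\<lambda>x::'a. 0)" by blast
  then show ?case by (simp add: zero_fun_def)
next
  case (step c f g)
  then obtain e where "f = monomial_fun e" by auto
  then have "real_polynomial_function f"
    unfolding monomial_fun_def
    by (auto intro!: real_polynomial_function_prod real_polynomial_function_power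
        simp: bounded_linear_inner_left)
  then have "real_polynomial_function (\<lambda>x. c * f x + g x)"
    using step(2) \<open>real_polynomial_function f\<close>
    by (intro real_polynomial_function.intros(2-4))
  then show ?case by (simp add: plus_fun_def)
qed

lemma poly_space_eqI:
  fixes p q :: "'a::euclidean_space \<Rightarrow> real"
  assumes "p \<in> poly_space X k" "q \<in> poly_space X' k'"
    and "interior S \<noteq> {}" and eq: "\<And>x. x \<in> S \<Longrightarrow> p x = q x"
  shows "p = q"
proof
  fix x
  obtain a where a: "a \<in> interior S" using assms by blast
  define h where "h = (\<lambda>t::real. p (a + t *\<^sub>R (x - a)) - q (a + t *\<^sub>R (x - a)))"
  have l: "polynomial_function (\<lambda>t::real. a + t *\<^sub>R (x - a))"
    by (intro polynomial_function_add polynomial_function_const polynomial_function_mult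
        polynomial_function_id)
  have "real_polynomial_function (p \<circ> (\<lambda>t. a + t *\<^sub>R (x - a)))"
    "real_polynomial_function (q \<circ> (\<lambda>t. a + t *\<^sub>R (x - a)))"
    using l assms(1,2) by (auto intro: real_polynomial_function_compose
        poly_space_real_polynomial_function)
  then have "real_polynomial_function h"
    unfolding h_def by (auto simp: o_def intro: real_polynomial_function_diff)
  then obtain c n where hc: "h = (\<lambda>t. \<Sum>i\<le>n. c i * t ^ i)"
    unfolding real_polynomial_function_iff_sum by blast
  have "continuous (at 0) (\<lambda>t::real. a + t *\<^sub>R (x - a))" by (intro continuous_intros)
  then have "\<forall>\<^sub>F t in at 0. a + t *\<^sub>R (x - a) \<in> interior S"
    using a by (auto simp: continuous_at elim!: topological_tendstoD)
  then have "\<forall>\<^sub>F t in at 0. h t = 0"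
    by eventually_elim (use eq interior_subset in \<open>auto simp: h_def\<close>)
  then obtain d where d: "d > 0" "\<And>t. t \<noteq> 0 \<Longrightarrow> dist t 0 < d \<Longrightarrow> h t = 0"
    unfolding eventually_at by auto
  have "{0<..<d} \<subseteq> {t. h t = 0}" using d by (auto simp: dist_real_def)
  then have "infinite {t. h t = 0}"
    using \<open>d > 0\<close> by (meson finite_subset infinite_Ioo)
  then have "\<And>i. i \<le> n \<Longrightarrow> c i = 0"
    unfolding hc using polyfun_rootbound_finite by blast
  then have "h 1 = 0" by (simp add: hc)
  then show "p x = q x" by (simp add: h_def)
qed

definition extended_space :: "('a \<Rightarrow> real) set \<Rightarrow> ('a \<Rightarrow> real) \<Rightarrow> ('a \<Rightarrow> real) set" where
  "extended_space V \<psi> = {v + w |v w. v \<in> V \<and> w \<in> fun_space.span {\<psi>}}"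

definition feasible ::
  "'a::euclidean_space set \<Rightarrow> (('a \<Rightarrow> real) \<Rightarrow> ('a \<Rightarrow> real) \<Rightarrow> real) \<Rightarrow> ('a \<Rightarrow> real) set \<Rightarrow> ('a \<Rightarrow> real) \<Rightarrow> bool"
where
  "feasible S L V \<psi> \<longleftrightarrow>
     (\<exists>v\<in>extended_space V \<psi>. (\<forall>p\<in>S. 0 \<le> v p) \<and>
        (\<forall>u\<in>extended_space V \<psi>. L u v = (LINT p:S|lebesgue. u p)))"

definition augmented_space ::
  "'a::euclidean_space set \<Rightarrow> (('a \<Rightarrow> real) \<Rightarrow> ('a \<Rightarrow> real) \<Rightarrow> real) \<Rightarrow>
   poly_family \<Rightarrow> nat \<Rightarrow> nat \<Rightarrow> ('a \<Rightarrow> real) \<Rightarrow> bool"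
where
  "augmented_space S L X k r \<psi> \<longleftrightarrow>
     \<psi> \<in> poly_space X r - poly_space X k \<and> feasible S L (poly_space X k) \<psi>"

definition local_solution ::
  "('a \<Rightarrow> real) set \<Rightarrow> (('a \<Rightarrow> real) \<Rightarrow> ('a \<Rightarrow> real) \<Rightarrow> real) \<Rightarrow> (('a \<Rightarrow> real) \<Rightarrow> real) \<Rightarrow> ('a \<Rightarrow> real) \<Rightarrow> bool"
where
  "local_solution V L R u \<longleftrightarrow> u \<in> V \<and> (\<forall>v\<in>V. L u v = R v)"

definition cell_average :: "'a::euclidean_space set \<Rightarrow> ('a \<Rightarrow> real) \<Rightarrow> real" where
  "cell_average S u = (1 / measure lebesgue S) * (LINT p:S|lebesgue. u p)"

definition dg_lhs_2d ::
  "real \<Rightarrow> real \<Rightarrow> real \<Rightarrow> real \<Rightarrow> (real \<times> real \<Rightarrow> real) \<Rightarrow> (real \<times> real \<Rightarrow> real) \<Rightarrow> (real \<times> real \<Rightarrow> real) \<Rightarrow>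
   (real \<times> real \<Rightarrow> real) \<Rightarrow> (real \<times> real \<Rightarrow> real) \<Rightarrow> real"
where
  "dg_lhs_2d xm xp ym yp \<alpha> \<beta> \<gamma> u v =
     - set_lebesgue_integral lebesgue ({xm..xp} \<times> {ym..yp})
         (\<lambda>(x, y). u (x, y) * (\<alpha> (x, y) * deriv (\<lambda>s. v (s, y)) x + \<beta> (x, y) * deriv (\<lambda>s. v (x, s)) y))
     + (LINT y:{ym..yp}|lebesgue. \<alpha> (xp, y) * u (xp, y) * v (xp, y))
     + (LINT x:{xm..xp}|lebesgue. \<beta> (x, yp) * u (x, yp) * v (x, yp))
     + (LINT p:{xm..xp} \<times> {ym..yp}|lebesgue. \<gamma> p * u p * v p)"

definition dg_rhs_2d ::
  "real \<Rightarrow> real \<Rightarrow> real \<Rightarrow> real \<Rightarrow> (real \<times> real \<Rightarrow> real) \<Rightarrow> (real \<times> real \<Rightarrow> real) \<Rightarrow>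
   (real \<times> real \<Rightarrow> real) \<Rightarrow> (real \<Rightarrow> real) \<Rightarrow> (real \<Rightarrow> real) \<Rightarrow> (real \<times> real \<Rightarrow> real) \<Rightarrow> real"
where
  "dg_rhs_2d xm xp ym yp \<alpha> \<beta> f g1 g2 v =
     (LINT p:{xm..xp} \<times> {ym..yp}|lebesgue. f p * v p)
     + (LINT y:{ym..yp}|lebesgue. \<alpha> (xm, y) * g1 y * v (xm, y))
     + (LINT x:{xm..xp}|lebesgue. \<beta> (x, ym) * g2 x * v (x, ym))"

definition dg_lhs_3d ::
  "real \<Rightarrow> real \<Rightarrow> real \<Rightarrow> real \<Rightarrow> real \<Rightarrow> real \<Rightarrow> real \<Rightarrow> real \<Rightarrow> real \<Rightarrow>
   (real \<times> real \<times> real \<Rightarrow> real) \<Rightarrow> (real \<times> real \<times> real \<Rightarrow> real) \<Rightarrow> real"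
where
  "dg_lhs_3d xm xp ym yp tm tp \<alpha> \<beta> \<gamma> u v =
     - set_lebesgue_integral lebesgue ({xm..xp} \<times> {ym..yp} \<times> {tm..tp})
         (\<lambda>(x, y, t). u (x, y, t) *
            (\<alpha> * deriv (\<lambda>s. v (s, y, t)) x + \<beta> * deriv (\<lambda>s. v (x, s, t)) y
             + deriv (\<lambda>s. v (x, y, s)) t - \<gamma> * v (x, y, t)))
     + \<alpha> * (LINT t:{tm..tp}|lebesgue. LINT y:{ym..yp}|lebesgue. u (xp, y, t) * v (xp, y, t))
     + \<beta> * (LINT t:{tm..tp}|lebesgue. LINT x:{xm..xp}|lebesgue. u (x, yp, t) * v (x, yp, t))
     + (LINT y:{ym..yp}|lebesgue. LINT x:{xm..xp}|lebesgue. u (x, y, tp) * v (x, y, tp))"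

definition dg_rhs_3d ::
  "real \<Rightarrow> real \<Rightarrow> real \<Rightarrow> real \<Rightarrow> real \<Rightarrow> real \<Rightarrow> real \<Rightarrow> real \<Rightarrow>
   (real \<times> real \<times> real \<Rightarrow> real) \<Rightarrow> (real \<times> real \<Rightarrow> real) \<Rightarrow> (real \<times> real \<Rightarrow> real) \<Rightarrow>
   (real \<times> real \<Rightarrow> real) \<Rightarrow> (real \<times> real \<times> real \<Rightarrow> real) \<Rightarrow> real"
where
  "dg_rhs_3d xm xp ym yp tm tp \<alpha> \<beta> f g1 g2 g3 v =
     (LINT p:{xm..xp} \<times> {ym..yp} \<times> {tm..tp}|lebesgue. f p * v p)
     + \<alpha> * (LINT t:{tm..tp}|lebesgue. LINT y:{ym..yp}|lebesgue. g1 (y, t) * v (xm, y, t))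
     + \<beta> * (LINT t:{tm..tp}|lebesgue. LINT x:{xm..xp}|lebesgue. g2 (x, t) * v (x, ym, t))
     + (LINT y:{ym..yp}|lebesgue. LINT x:{xm..xp}|lebesgue. g3 (x, y) * v (x, y, tm))"

end

theory Submission
  imports Defs
begin

text \<open>The integrand extended by 0 outside \<open>A\<close> is pointwise non-negative, and the
  Bochner integral of a non-integrable function is 0 by convention. The sign therefore survives for
  products like \<open>f p * v p\<close> and for individual slices of the data, whatever their
  integrability.\<close>

lemma set_integral_nonneg:
  fixes f :: "'a \<Rightarrow> real"
  assumes "\<And>x. x \<in> A \<Longrightarrow> 0 \<le> f x"
  shows "0 \<le> (LINT x:A|M. f x)"
  unfolding set_lebesgue_integral_def
  by (rule integral_nonneg_AE) (auto simp: assms indicator_def)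

text \<open>
  The feasibility test function \<open>v\<close> represents the cell integral, so testing the scheme with it gives
  \<open>\<integral>\<^sub>S u = \<L>(u, v) = \<R>(v)\<close>, and \<open>\<R>(v) \<ge> 0\<close> because \<open>v\<close> and the data are non-negative.
\<close>

lemma cell_average_nonneg:
  fixes S :: "'a::euclidean_space set"
  assumes "augmented_space S L X k r \<psi>"
    and "local_solution (extended_space (poly_space X k) \<psi>) L R u"
    and R_nonneg: "\<And>v. \<forall>p\<in>S. 0 \<le> v p \<Longrightarrow> 0 \<le> R v"
  shows "0 \<le> cell_average S u"
proof -
  obtain v where "v \<in> extended_space (poly_space X k) \<psi>" "\<forall>p\<in>S. 0 \<le> v p"
    "\<forall>w\<in>extended_space (poly_space X k) \<psi>. L w v = (LINT p:S|lebesgue. w p)"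
    using assms(1) unfolding augmented_space_def feasible_def by blast
  moreover from this have "(LINT p:S|lebesgue. u p) = R v"
    using assms(2) unfolding local_solution_def by metis
  ultimately show ?thesis
    \<comment> \<open>The factor \<open>1 / measure lebesgue S\<close> is non-negative for any
      \<open>S\<close>: where the measure is 0, division by zero yields 0.\<close>
    using R_nonneg by (simp add: cell_average_def)
qed

text \<open>Every integrand is a product of non-negative factors. The cell is closed, so
  \<open>xm \<le> xp\<close> and \<open>ym \<le> yp\<close> place the inflow edges inside it, and
  the signs of \<open>v\<close>, \<open>\<alpha>\<close> and \<open>\<beta>\<close> on the cell pass
  to their edge traces.\<close>

lemma dg_rhs_2d_nonneg:
  assumes "xm \<le> xp" "ym \<le> yp"
    and "\<And>p. p \<in> {xm..xp} \<times> {ym..yp} \<Longrightarrow> 0 \<le> \<alpha> p"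
    and "\<And>p. p \<in> {xm..xp} \<times> {ym..yp} \<Longrightarrow> 0 \<le> \<beta> p"
    and "\<And>p. p \<in> {xm..xp} \<times> {ym..yp} \<Longrightarrow> 0 \<le> f p"
    and "\<And>y. y \<in> {ym..yp} \<Longrightarrow> 0 \<le> g1 y"
    and "\<And>x. x \<in> {xm..xp} \<Longrightarrow> 0 \<le> g2 x"
    and "\<And>p. p \<in> {xm..xp} \<times> {ym..yp} \<Longrightarrow> 0 \<le> v p"
  shows "0 \<le> dg_rhs_2d xm xp ym yp \<alpha> \<beta> f g1 g2 v"
  unfolding dg_rhs_2d_def
  by (intro add_nonneg_nonneg set_integral_nonneg mult_nonneg_nonneg assms) (use assms(1,2) in auto)

text \<open>As in two dimensions, except that the face terms are iterated integrals:
  \<open>set_integral_nonneg\<close> applies first to the outer integral, then to the inner one at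
  each fixed outer variable.\<close>

lemma dg_rhs_3d_nonneg:
  assumes "xm \<le> xp" "ym \<le> yp" "tm \<le> tp" "0 \<le> \<alpha>" "0 \<le> \<beta>"
    and "\<And>p. p \<in> {xm..xp} \<times> {ym..yp} \<times> {tm..tp} \<Longrightarrow> 0 \<le> f p"
    and "\<And>q. q \<in> {ym..yp} \<times> {tm..tp} \<Longrightarrow> 0 \<le> g1 q"
    and "\<And>q. q \<in> {xm..xp} \<times> {tm..tp} \<Longrightarrow> 0 \<le> g2 q"
    and "\<And>q. q \<in> {xm..xp} \<times> {ym..yp} \<Longrightarrow> 0 \<le> g3 q"
    and "\<And>p. p \<in> {xm..xp} \<times> {ym..yp} \<times> {tm..tp} \<Longrightarrow> 0 \<le> v p"
  shows "0 \<le> dg_rhs_3d xm xp ym yp tm tp \<alpha> \<beta> f g1 g2 g3 v"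
  unfolding dg_rhs_3d_def
  by (intro add_nonneg_nonneg set_integral_nonneg mult_nonneg_nonneg assms) (use assms(1-3) in auto)

theorem theorem1:
  fixes k r :: nat and X :: poly_family
  assumes "1 \<le> k" and "k < r"
  shows
    "(\<forall>(xm::real) xp ym yp (\<alpha> :: real \<times> real \<Rightarrow> real) \<beta> \<gamma> f (g1 :: real \<Rightarrow> real) (g2 :: real \<Rightarrow> real) \<psi> u.
        let S = {xm..xp} \<times> {ym..yp};
            L = dg_lhs_2d xm xp ym yp \<alpha> \<beta> \<gamma>;
            R = dg_rhs_2d xm xp ym yp \<alpha> \<beta> f g1 g2
        in
        xm < xp \<and> ym < yp \<and>
        continuous_on S \<alpha> \<and> continuous_on S \<beta> \<and> continuous_on S \<gamma> \<and>
        (\<forall>p\<in>S. 0 < \<alpha> p) \<and> (\<forall>p\<in>S. 0 < \<beta> p) \<and> (\<forall>p\<in>S. 0 \<le> \<gamma> p) \<and>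
        set_integrable lebesgue S f \<and>
        set_integrable lebesgue {ym..yp} g1 \<and> set_integrable lebesgue {xm..xp} g2 \<and>
        augmented_space S L X k r \<psi> \<and>
        local_solution (extended_space (poly_space X k) \<psi>) L R u \<and>
        (\<forall>p\<in>S. 0 \<le> f p) \<and> (\<forall>y\<in>{ym..yp}. 0 \<le> g1 y) \<and> (\<forall>x\<in>{xm..xp}. 0 \<le> g2 x)
        \<longrightarrow> 0 \<le> cell_average S u)
     \<and>
     (\<forall>(xm::real) xp ym yp tm tp (\<alpha>::real) \<beta> \<gamma> (f :: real \<times> real \<times> real \<Rightarrow> real)
        (g1 :: real \<times> real \<Rightarrow> real) (g2 :: real \<times> real \<Rightarrow> real) (g3 :: real \<times> real \<Rightarrow> real) \<psi> u.
        let S = {xm..xp} \<times> {ym..yp} \<times> {tm..tp};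
            L = dg_lhs_3d xm xp ym yp tm tp \<alpha> \<beta> \<gamma>;
            R = dg_rhs_3d xm xp ym yp tm tp \<alpha> \<beta> f g1 g2 g3
        in
        xm < xp \<and> ym < yp \<and> tm < tp \<and>
        0 < \<alpha> \<and> 0 < \<beta> \<and> 0 \<le> \<gamma> \<and>
        set_integrable lebesgue S f \<and>
        set_integrable lebesgue ({ym..yp} \<times> {tm..tp}) g1 \<and>
        set_integrable lebesgue ({xm..xp} \<times> {tm..tp}) g2 \<and>
        set_integrable lebesgue ({xm..xp} \<times> {ym..yp}) g3 \<and>
        augmented_space S L X k r \<psi> \<and>
        local_solution (extended_space (poly_space X k) \<psi>) L R u \<and>
        (\<forall>p\<in>S. 0 \<le> f p) \<and>
        (\<forall>q\<in>{ym..yp} \<times> {tm..tp}. 0 \<le> g1 q) \<and>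
        (\<forall>q\<in>{xm..xp} \<times> {tm..tp}. 0 \<le> g2 q) \<and>
        (\<forall>q\<in>{xm..xp} \<times> {ym..yp}. 0 \<le> g3 q)
        \<longrightarrow> 0 \<le> cell_average S u)"
  unfolding Let_def
  \<comment> \<open>Matching the augmented-space and local-solution hypotheses fixes
    \<open>S\<close>, \<open>L\<close> and \<open>R\<close>, so one abstract lemma serves both
    dimensions. What remains is the sign of the concrete right-hand side, with the strict
    inequalities weakened.\<close>
  by (intro conjI allI impI; elim conjE; erule (1) cell_average_nonneg)
    (auto intro!: dg_rhs_2d_nonneg dg_rhs_3d_nonneg intro: less_imp_le)

end
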